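(* Suppose that $\mathbf{A}(x,\lambda)$ is an $n\times n$ matrix-valued function, periodic in $x$ with period $T>0$, and that (A1) and (A2) (stated in the context) hold true. Let $\mathbf{M}(\lambda)$ denote the monodromy matrix of $\mathbf{v}_x=\mathbf{A}(x,\lambda)\mathbf{v}$. Then $$\mathbf{M}(\lambda)=\mathbf{B}^{-\top}(\lambda)\,\mathbf{M}^{-\top}(-\lambda)\,\mathbf{B}^{\top}(\lambda)$$ (for $\lambda$ at which $\mathbf{B}(\lambda)$ is nonsingular). Additionally, suppose that $\operatorname{tr}(\mathbf{A}(x,\lambda))=0$ for all $x\in\mathbb{R}$ and $\lambda\in\mathbb{C}$. Let the characteristic polynomial of the monodromy matrix take the form $$p(\mu,\lambda)=\det(\mathbf{M}(\lambda)-\mu\mathbf{I}_n)=\sum_{k=0}^n(-\mu)^k e_{n-k}(\lambda),$$ where $e_k(\lambda)$ denotes the $k$-th elementary symmetric polynomial of the eigenvalues $\mu_1,\dots,\mu_n$ of $\mathbf{M}(\lambda)$ (counted with algebraic multiplicity), that is, $e_0(\lambda)=1$ and $e_k(\lambda)=\sum_{1\le j_1<j_2<\dots<j_k\le n}\mu_{j_1}\mu_{j_2}\cdots\mu_{j_k}$ for $k=1,2,\dots,n$. Then $$e_k(\lambda)=e_{n-k}(-\lambda),\qquad k=0,1,2,\dots,n,\quad\text{for }\lambda\in\mathbb{C},$$ and, in turn, $$e_k(\lambda)=\overline{e_{n-k}(\lambda)},\qquad k=0,1,2,\dots,n,\quad\text{for }\lambda\in i\mathbb{R}.$$ Particularly,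 for $n$ even, $e_{n/2}(\lambda)$ is necessarily real (for $\lambda\in i\mathbb{R}$).
   Context: Here $x\in\mathbb{R}$, $\lambda\in\mathbb{C}$, and periodicity means $\mathbf{A}(x+T,\lambda)=\mathbf{A}(x,\lambda)$. Assumptions (generalized Hamiltonian symmetry). (A1) $\mathbf{A}(x,\lambda)$ is real for $\lambda\in\mathbb{R}$. (A2) $\mathbf{A}^\top(x,\lambda)\mathbf{B}(\lambda)=-\mathbf{B}(\lambda)\mathbf{A}(x,-\lambda)$ for some matrix $\mathbf{B}(\lambda)$, independent of $x$, and nonsingular everywhere except for at most finitely many values of $\lambda$. The superscript $\top$ denotes the (non-conjugated) transpose, and $\mathbf{X}^{-\top}=(\mathbf{X}^{-1})^\top$. Monodromy matrix: $\mathbf{M}(\lambda)=\mathbf{V}(T,\lambda)$, where $\mathbf{V}_x=\mathbf{A}(x,\lambda)\mathbf{V}$ and $\mathbf{V}(0,\lambda)=\mathbf{I}_n$, the $n\times n$ identity matrix.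
   Formalization: The symmetry e_k(λ)=e_{n-k}(-λ) is proved for A jointly continuous in (x,λ), and the conjugate symmetry and the reality of e_{n/2} on iℝ for A also entire in λ; without such regularity these claims fail. *)

theory Defs
  imports "HOL-Analysis.Analysis" "HOL-Computational_Algebra.Polynomial"
begin

text \<open>
  \<open>N\<close> is the value at \<open>T\<close> of a solution \<open>V\<close> of the matrix equation \<open>V' = A(x) V\<close>, \<open>V(0) = I\<close>
  on the whole real line. For continuous \<open>A\<close> such a \<open>V\<close> exists and is unique, so that \<open>N\<close> is
  the monodromy matrix.
\<close>
definition is_monodromy_matrix ::
    "(real \<Rightarrow> complex ^ 'n ^ 'n) \<Rightarrow> real \<Rightarrow> complex ^ 'n ^ 'n \<Rightarrow> bool" where
  "is_monodromy_matrix A T N \<longleftrightarrow>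
     (\<exists>V. V 0 = mat 1 \<and>
          (\<forall>x. (V has_vector_derivative (A x ** V x)) (at x)) \<and>
          N = V T)"

text \<open>The polynomial \<open>det (N - X I)\<close> in the indeterminate \<open>X = [:0, 1:]\<close>.\<close>
definition charpoly :: "complex ^ 'n ^ 'n \<Rightarrow> complex poly" where
  "charpoly N = det (map_matrix (\<lambda>c. [:c:]) N - mat [:0, 1:])"

text \<open>
  \<open>\<mu> 1, \<dots>, \<mu> n\<close> lists the eigenvalues of the \<open>n \<times> n\<close> matrix \<open>N\<close>, each as often as its
  multiplicity as a root of the characteristic polynomial; values of \<open>\<mu>\<close> outside \<open>{1..n}\<close>
  are irrelevant.
\<close>
definition enumerates_eigenvalues :: "(nat \<Rightarrow> complex) \<Rightarrow> complex ^ 'n ^ 'n \<Rightarrow> bool" where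
  "enumerates_eigenvalues \<mu> N \<longleftrightarrow>
     (\<forall>z. card {j \<in> {1..CARD('n)}. \<mu> j = z} = order z (charpoly N))"

definition elem_sym :: "nat \<Rightarrow> nat \<Rightarrow> (nat \<Rightarrow> 'a::comm_ring_1) \<Rightarrow> 'a" where
  "elem_sym n k \<mu> = (\<Sum>J | J \<subseteq> {1..n} \<and> card J = k. \<Prod>j\<in>J. \<mu> j)"

end

theory Submission
  imports Defs "HOL-Complex_Analysis.Conformal_Mappings"
    "HOL-Computational_Algebra.Fundamental_Theorem_Algebra"
begin

unbundle no fps_syntax

text \<open>
  Write \<open>V\<^sub>\<lambda>\<close> for the fundamental solution with parameter \<open>\<lambda>\<close>, so that \<open>M(\<lambda>) = V\<^sub>\<lambda>(T)\<close>.
  The symmetry \<open>A\<^sup>T(\<lambda>) B(\<lambda>) = - B(\<lambda>) A(- \<lambda>)\<close> says exactly that the bilinear form with matrix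
  \<open>B(\<lambda>)\<close> is conserved along a pair of solutions with parameters \<open>\<lambda>\<close> and \<open>- \<lambda>\<close>. Evaluating the
  conserved quantity \<open>V\<^sub>\<lambda>\<^sup>T B(\<lambda>) V\<^bsub>-\<lambda>\<^esub>\<close> at \<open>0\<close> and at \<open>T\<close> gives
  \<open>M\<^sup>T(\<lambda>) B(\<lambda>) M(- \<lambda>) = B(\<lambda>)\<close> for every \<open>\<lambda>\<close> (lemma \<open>monodromy_preserves_form\<close>). Where \<open>B(\<lambda>)\<close> is
  invertible, solving this for \<open>M(\<lambda>)\<close> is the first claim.

  If the trace of \<open>A\<close> vanishes, Liouville's formula (\<open>has_vector_derivative_det\<close>) gives
  \<open>det M = 1\<close>. Multiplying the relation above out as
  \<open>(M\<^sup>T(\<lambda>) - z) B(\<lambda>) M(- \<lambda>) = B(\<lambda>) (1 - z M(- \<lambda>))\<close> and taking determinants yields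
  \<open>det (M(\<lambda>) - z) = det (1 - z M(- \<lambda>))\<close> (\<open>form_preserving_det\<close>). The right-hand side is the
  reversed characteristic polynomial of \<open>M(- \<lambda>)\<close>, so comparing coefficients of powers of \<open>- z\<close>
  gives \<open>e\<^sub>k(\<lambda>) = e\<^bsub>n-k\<^esub>(- \<lambda>)\<close>. This works only where \<open>B(\<lambda>)\<close> is invertible. Both
  determinants are continuous in \<open>\<lambda>\<close>, because \<open>M\<close> depends continuously on \<open>\<lambda>\<close>
  (\<open>continuous_on_matrix_ode_parameter\<close>), so the identity persists at the finitely many exceptional
  values.

  Finally, if \<open>A\<close> is entire in \<open>\<lambda>\<close> and real on the real axis, it commutes with complex conjugation
  (\<open>entire_real_on_reals_cnj\<close>). By uniqueness of solutions so does \<open>M\<close>, and hence so does each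
  \<open>e\<^sub>k\<close>. On the imaginary axis conjugation is \<open>\<lambda> \<mapsto> - \<lambda>\<close>, which turns the previous symmetry
  into \<open>e\<^sub>k = cnj e\<^bsub>n-k\<^esub>\<close>.
\<close>

section \<open>Matrix calculus\<close>

lemma bounded_bilinear_matrix_matrix_mult:
  "bounded_bilinear ((**) :: complex ^ 'n ^ 'm \<Rightarrow> complex ^ 'p ^ 'n \<Rightarrow> complex ^ 'p ^ 'm)"
  unfolding bilinear_conv_bounded_bilinear [symmetric] bilinear_def linear_iff
  by (simp add: vec_eq_iff matrix_matrix_mult_def distrib_left distrib_right sum.distrib
      scaleR_sum_right)

lemma bounded_linear_transpose:
  "bounded_linear (transpose :: complex ^ 'n ^ 'm \<Rightarrow> complex ^ 'm ^ 'n)"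
  unfolding linear_conv_bounded_linear [symmetric] linear_iff
  by (simp add: transpose_def vec_eq_iff)

lemma bounded_linear_map_matrix_cnj:
  "bounded_linear (map_matrix cnj :: complex ^ 'n ^ 'm \<Rightarrow> complex ^ 'n ^ 'm)"
  unfolding linear_conv_bounded_linear [symmetric] linear_iff
  by (simp add: vec_eq_iff)

lemma map_matrix_cnj_mult:
  "map_matrix cnj (X ** Y) = map_matrix cnj X ** map_matrix cnj Y"
  by (simp add: vec_eq_iff matrix_matrix_mult_def)

lemma det_map_matrix_cnj: "det (map_matrix cnj X) = cnj (det X)"
  by (simp add: det_def)

lemma
  fixes X :: "'a::comm_semiring_1 ^ 'n ^ 'n"
  shows mat_mult_nth: "(mat c ** X) $ i $ j = c * X $ i $ j"
    and mult_mat_nth: "(X ** mat c) $ i $ j = c * X $ i $ j"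
  by (simp_all add: matrix_matrix_mult_def mat_def if_distrib if_distribR mult.commute cong: if_cong)

lemma mat_mult_commute:
  fixes X :: "'a::comm_semiring_1 ^ 'n ^ 'n"
  shows "mat c ** X = X ** mat c"
  by (simp add: vec_eq_iff mat_mult_nth mult_mat_nth)

lemma det_mat: "det (mat c :: 'a::comm_ring_1 ^ 'n ^ 'n) = c ^ CARD('n)"
  by (subst det_diagonal) (auto simp: mat_def)

lemma continuous_on_det:
  fixes F :: "'a::topological_space \<Rightarrow> complex ^ 'n ^ 'n"
  assumes "continuous_on S F"
  shows "continuous_on S (\<lambda>x. det (F x))"
  unfolding det_def by (intro continuous_intros assms)

lemma
  fixes X :: "'a::semiring_1 ^ 'n ^ 'm"
  assumes "invertible X"
  shows matrix_inv_right: "X ** matrix_inv X = mat 1"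
    and matrix_inv_left: "matrix_inv X ** X = mat 1"
proof -
  have "X ** matrix_inv X = mat 1 \<and> matrix_inv X ** X = mat 1"
    using assms unfolding invertible_def matrix_inv_def by (rule someI_ex)
  then show "X ** matrix_inv X = mat 1" "matrix_inv X ** X = mat 1"
    by auto
qed

section \<open>The characteristic polynomial\<close>

lemma poly_charpoly: "poly (charpoly N) z = det (N - mat z)"
  unfolding charpoly_def det_def poly_sum
  by (rule sum.cong) (auto simp: poly_prod mat_def intro!: prod.cong)

text \<open>
  Each factor contributes its linear coefficient to the top one; this is how the leading term of a
  characteristic polynomial is read off from the permutation expansion. The degrees are bounded
  above rather than fixed, since only the diagonal entries of \<open>N - X\<close> are genuinely linear.
\<close>

lemma prod_linear_polys:
  fixes q :: "'i \<Rightarrow> 'a::idom poly"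
  assumes "finite S" "\<And>i. i \<in> S \<Longrightarrow> degree (q i) \<le> 1"
  shows "degree (\<Prod>i\<in>S. q i) \<le> card S \<and>
    coeff (\<Prod>i\<in>S. q i) (card S) = (\<Prod>i\<in>S. coeff (q i) 1)"
  using assms
proof (induction S rule: finite_induct)
  case (insert i S)
  let ?r = "\<Prod>i\<in>S. q i"
  have IH: "degree ?r \<le> card S" "coeff ?r (card S) = (\<Prod>i\<in>S. coeff (q i) 1)"
    using insert by auto
  have deg: "degree (q i) \<le> 1"
    using insert by auto
  define a b where "a = coeff (q i) 0" and "b = coeff (q i) 1"
  have q: "q i = [:a, b:]"
    using deg by (intro poly_eqI) (auto simp: a_def b_def coeff_pCons coeff_eq_0 split: nat.split)
  have "degree (q i * ?r) \<le> Suc (card S)"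
    using degree_mult_le [of "q i" ?r] deg IH(1) by linarith
  moreover have "coeff (q i * ?r) (Suc (card S)) = b * coeff ?r (card S)"
    using IH(1) by (simp add: q coeff_eq_0)
  ultimately show ?case
    using insert IH by (simp add: q)
qed simp

text \<open>
  Taking the coefficient of order \<open>n\<close> in the permutation expansion of \<open>det (N - X)\<close> replaces every
  entry by its linear coefficient, so that the result is \<open>det (- I)\<close>.
\<close>

lemma
  fixes N :: "complex ^ 'n ^ 'n"
  shows degree_charpoly: "degree (charpoly N) = CARD('n)"
    and lead_coeff_charpoly: "lead_coeff (charpoly N) = (- 1) ^ CARD('n)"
proof -
  let ?P = "map_matrix (\<lambda>c. [:c:]) N - mat [:0, 1:] :: complex poly ^ 'n ^ 'n"
  have deg: "degree (?P $ i $ j) \<le> 1" for i j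
    by (simp add: mat_def)
  have prod: "degree (\<Prod>i\<in>UNIV. ?P $ i $ p i) \<le> CARD('n)"
    "coeff (\<Prod>i\<in>UNIV. ?P $ i $ p i) CARD('n) = (\<Prod>i\<in>UNIV. coeff (?P $ i $ p i) 1)" for p
    using prod_linear_polys [of UNIV "\<lambda>i. ?P $ i $ p i"] deg by auto
  have le: "degree (charpoly N) \<le> CARD('n)"
    unfolding charpoly_def det_def
  proof (intro degree_sum_le finite_permutations finite)
    fix p
    show "degree (of_int (sign p) * (\<Prod>i\<in>UNIV. ?P $ i $ p i)) \<le> CARD('n)"
      by (rule order_trans [OF degree_mult_le]) (use prod(1) [of p] in \<open>simp only: degree_of_int add_0\<close>)
  qed
  have "coeff (charpoly N) CARD('n) =
      (\<Sum>p | p permutes UNIV. of_int (sign p) * (\<Prod>i\<in>UNIV. coeff (?P $ i $ p i) 1))"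
    unfolding charpoly_def det_def by (simp only: coeff_sum of_int_poly mult_pCons_left)
      (simp add: prod(2) [simplified])
  also have "\<dots> = det (mat (- 1) :: complex ^ 'n ^ 'n)"
    unfolding det_def by (intro sum.cong prod.cong refl arg_cong2 [where f = "(*)"]) (simp add: mat_def)
  also have "\<dots> = (- 1) ^ CARD('n)"
    by (rule det_mat)
  finally have c: "coeff (charpoly N) CARD('n) = (- 1) ^ CARD('n)" .
  then have "coeff (charpoly N) CARD('n) \<noteq> 0"
    by simp
  with le show deg: "degree (charpoly N) = CARD('n)"
    by (meson le_degree order_antisym)
  show "lead_coeff (charpoly N) = (- 1) ^ CARD('n)"
    using c deg by simp
qed

text \<open>
  Over the complex numbers the polynomial splits; grouping the factors of the right-hand side by
  the value of \<open>\<mu>\<close> turns the multiplicities into root orders.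
\<close>

lemma charpoly_eq_prod:
  fixes N :: "complex ^ 'n ^ 'n"
  assumes "enumerates_eigenvalues \<mu> N"
  shows "charpoly N = (\<Prod>j = 1..CARD('n). [:\<mu> j, - 1:])"
proof -
  let ?n = "CARD('n)" and ?p = "charpoly N"
  let ?R = "{z. poly ?p z = 0}"
  have p0: "?p \<noteq> 0"
    using lead_coeff_charpoly [of N] by auto
  have card: "card {j \<in> {1..?n}. \<mu> j = z} = order z ?p" for z
    using assms by (simp add: enumerates_eigenvalues_def)
  have "\<mu> ` {1..?n} \<subseteq> ?R"
  proof clarify
    fix j assume "j \<in> {1..?n}"
    then have "card {i \<in> {1..?n}. \<mu> i = \<mu> j} \<noteq> 0"
      by (auto simp: card_eq_0_iff)
    then show "poly ?p (\<mu> j) = 0"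
      by (simp only: card order_root) simp
  qed
  then have "(\<Prod>j = 1..?n. [:- \<mu> j, 1:]) =
      (\<Prod>z\<in>?R. \<Prod>j \<in> {j \<in> {1..?n}. \<mu> j = z}. [:- \<mu> j, 1:])"
    using p0 by (intro prod.group [symmetric]) (auto simp: poly_roots_finite)
  also have "\<dots> = (\<Prod>z\<in>?R. \<Prod>j \<in> {j \<in> {1..?n}. \<mu> j = z}. [:- z, 1:])"
    by (intro prod.cong refl) auto
  also have "\<dots> = (\<Prod>z\<in>?R. [:- z, 1:] ^ order z ?p)"
    by (simp only: prod_constant card)
  finally have "?p = smult ((- 1) ^ ?n) (\<Prod>j = 1..?n. [:- \<mu> j, 1:])"
    using complex_poly_decompose [of ?p] by (simp add: lead_coeff_charpoly)
  \<comment> \<open>The sign from the leading coefficient turns each \<open>X - \<mu> j\<close> into \<open>\<mu> j - X\<close>.\<close>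
  also have "\<dots> = (\<Prod>j = 1..?n. smult (- 1) [:- \<mu> j, 1:])"
    by (simp only: prod_smult) simp
  finally show ?thesis
    by simp
qed

lemma prod_minus_eq_sum_elem_sym:
  fixes \<mu> :: "nat \<Rightarrow> 'a::comm_ring_1"
  shows "(\<Prod>j = 1..n. \<mu> j - z) = (\<Sum>k = 0..n. (- z) ^ k * elem_sym n (n - k) \<mu>)"
proof -
  have "(\<Prod>j = 1..n. \<mu> j - z) = (\<Prod>j = 1..n. \<mu> j + (- z))"
    by simp
  also have "\<dots> = (\<Sum>J\<in>Pow {1..n}. prod \<mu> J * (- z) ^ card ({1..n} - J))"
    by (subst prod_add) simp_all
  also have "\<dots> = (\<Sum>J\<in>Pow {1..n}. (- z) ^ (n - card J) * prod \<mu> J)"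
    by (intro sum.cong refl) (auto simp: card_Diff_subset finite_subset mult.commute)
  also have "\<dots> = (\<Sum>k = 0..n. \<Sum>J \<in> {J \<in> Pow {1..n}. n - card J = k}. (- z) ^ (n - card J) * prod \<mu> J)"
    by (intro sum.group [symmetric]) auto
  also have "\<dots> = (\<Sum>k = 0..n. (- z) ^ k * elem_sym n (n - k) \<mu>)"
  proof (rule sum.cong [OF refl])
    fix k assume k: "k \<in> {0..n}"
    have le: "card J \<le> n" if "J \<subseteq> {1..n}" for J
      using card_mono [OF _ that] by simp
    have "n - card J = k \<longleftrightarrow> card J = n - k" if "J \<subseteq> {1..n}" for J
      using le [OF that] k by auto
    then have "{J \<in> Pow {1..n}. n - card J = k} = {J. J \<subseteq> {1..n} \<and> card J = n - k}"
      by blast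
    then show "(\<Sum>J \<in> {J \<in> Pow {1..n}. n - card J = k}. (- z) ^ (n - card J) * prod \<mu> J) =
        (- z) ^ k * elem_sym n (n - k) \<mu>"
      using k by (simp add: elem_sym_def sum_distrib_left)
  qed
  finally show ?thesis .
qed

lemma det_minus_mat_eq_sum_elem_sym:
  fixes N :: "complex ^ 'n ^ 'n"
  assumes "enumerates_eigenvalues \<mu> N"
  shows "det (N - mat z) = (\<Sum>k = 0..CARD('n). (- z) ^ k * elem_sym CARD('n) (CARD('n) - k) \<mu>)"
proof -
  have "det (N - mat z) = (\<Prod>j = 1..CARD('n). \<mu> j - z)"
    by (simp add: poly_charpoly [symmetric] charpoly_eq_prod [OF assms] poly_prod)
  then show ?thesis
    by (simp only: prod_minus_eq_sum_elem_sym)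
qed

lemma elem_sym_0 [simp]: "elem_sym n 0 \<mu> = 1"
proof -
  have "{J. J \<subseteq> {1..n} \<and> card J = 0} = {{}}"
    by (auto simp: finite_subset card_eq_0_iff)
  then show ?thesis
    by (simp add: elem_sym_def)
qed

text \<open>
  This is the characteristic polynomial with its coefficients reversed: for \<open>z \<noteq> 0\<close>, factor \<open>- z\<close>
  out of \<open>I - z N\<close> to obtain \<open>(- z)\<^sup>n det (N - 1/z)\<close>.
\<close>

lemma det_one_minus_eq_sum_elem_sym:
  fixes N :: "complex ^ 'n ^ 'n"
  assumes "enumerates_eigenvalues \<mu> N"
  shows "det (mat 1 - mat z ** N) = (\<Sum>k = 0..CARD('n). (- z) ^ k * elem_sym CARD('n) k \<mu>)"
proof (cases "z = 0")
  case True
  then show ?thesis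
    by (simp add: power_0_left sum.delta if_distrib if_distribR cong: if_cong)
next
  case False
  let ?n = "CARD('n)"
  have "mat 1 - mat z ** N = mat (- z) ** (N - mat (1 / z))"
    using False by (simp add: vec_eq_iff mat_mult_nth) (simp add: mat_def field_simps)
  then have "det (mat 1 - mat z ** N) = (- z) ^ ?n * det (N - mat (1 / z))"
    by (simp add: det_mul det_mat)
  also have "\<dots> = (\<Sum>k = 0..?n. (- z) ^ ?n * ((- (1 / z)) ^ k * elem_sym ?n (?n - k) \<mu>))"
    by (simp add: det_minus_mat_eq_sum_elem_sym [OF assms] sum_distrib_left)
  also have "\<dots> = (\<Sum>k = 0..?n. (- z) ^ (?n - k) * elem_sym ?n (?n - k) \<mu>)"
  proof (rule sum.cong [OF refl])
    fix k assume "k \<in> {0..?n}"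
    then have "(- z) ^ ?n = (- z) ^ (?n - k) * (- z) ^ k"
      by (simp add: power_add [symmetric])
    moreover have "(- z) ^ k * (- (1 / z)) ^ k = 1"
      using False by (simp add: power_mult_distrib [symmetric])
    ultimately show "(- z) ^ ?n * ((- (1 / z)) ^ k * elem_sym ?n (?n - k) \<mu>) =
        (- z) ^ (?n - k) * elem_sym ?n (?n - k) \<mu>"
      by (simp add: mult.assoc [symmetric])
  qed
  also have "\<dots> = (\<Sum>k = 0..?n. (- z) ^ k * elem_sym ?n k \<mu>)"
    by (rule sum.reindex_bij_witness [where i = "\<lambda>k. ?n - k" and j = "\<lambda>k. ?n - k"]) auto
  finally show ?thesis .
qed

lemma coeffs_eq_of_eval_neg:
  fixes a b :: "nat \<Rightarrow> complex"
  assumes "\<And>z. (\<Sum>k = 0..n. (- z) ^ k * a k) = (\<Sum>k = 0..n. (- z) ^ k * b k)" and "k \<le> n"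
  shows "a k = b k"
proof -
  have "(\<Sum>k\<le>n. a k * z ^ k) = (\<Sum>k\<le>n. b k * z ^ k)" for z
    using assms(1) [of "- z"] by (simp add: atMost_atLeast0 mult.commute)
  then show ?thesis
    using assms(2) polyfun_eq_coeffs [of a n b] by blast
qed

section \<open>Linear matrix differential equations\<close>

text \<open>
  Liouville's formula. By multilinearity the derivative of \<open>det V\<close> is the sum over \<open>i\<close> of the
  determinants of \<open>V\<close> with row \<open>i\<close> replaced by row \<open>i\<close> of \<open>A V\<close>. That row is a combination of the
  rows of \<open>V\<close>, and all of them but row \<open>i\<close> itself, with coefficient \<open>A\<^bsub>ii\<^esub>\<close>, repeat another row.
\<close>

lemma has_vector_derivative_det:
  fixes V :: "real \<Rightarrow> complex ^ 'n ^ 'n"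
  assumes V: "(V has_vector_derivative A ** V x) (at x)"
  shows "((\<lambda>x. det (V x)) has_vector_derivative trace A * det (V x)) (at x)"
proof -
  define W where "W = A ** V x"
  have "((\<lambda>x. det (V x)) has_derivative
      (\<lambda>y. \<Sum>p | p permutes (UNIV :: 'n set). of_int (sign p) *
        (\<Sum>i\<in>UNIV. y *\<^sub>R (W $ i $ p i) * (\<Prod>j\<in>UNIV - {i}. V x $ j $ p j)))) (at x)"
  proof -
    have "((\<lambda>x. V x $ i $ j) has_derivative (\<lambda>y. y *\<^sub>R (W $ i $ j))) (at x)" for i j
      using bounded_linear.has_derivative [OF bounded_linear_vec_nth
          bounded_linear.has_derivative [OF bounded_linear_vec_nth
          V [unfolded has_vector_derivative_def]]]
      by (simp add: W_def)
    then show ?thesis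
      unfolding det_def
      by (intro has_derivative_sum has_derivative_mult_right has_derivative_prod)
  qed
  moreover have "(\<Sum>p | p permutes (UNIV :: 'n set). of_int (sign p) *
        (\<Sum>i\<in>UNIV. y *\<^sub>R (W $ i $ p i) * (\<Prod>j\<in>UNIV - {i}. V x $ j $ p j))) =
      y *\<^sub>R (\<Sum>i\<in>UNIV. det (\<chi> j. if j = i then W $ i else V x $ j))" for y
  proof -
    have "(\<Prod>j\<in>UNIV. (\<chi> j. if j = i then W $ i else V x $ j) $ j $ p j) =
        W $ i $ p i * (\<Prod>j\<in>UNIV - {i}. V x $ j $ p j)" for i and p :: "'n \<Rightarrow> 'n"
      by (subst prod.remove [of _ i]) (auto intro!: prod.cong)
    then show ?thesis
      unfolding det_def
      by (subst sum.swap) (simp add: sum_distrib_left scaleR_sum_right mult.assoc)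
  qed
  moreover have "(\<Sum>i\<in>UNIV. det (\<chi> j. if j = i then W $ i else V x $ j)) = trace A * det (V x)"
  proof -
    have "det (\<chi> j. if j = i then W $ i else V x $ j) = A $ i $ i * det (V x)" for i
    proof -
      have row: "W $ i = (\<Sum>k\<in>UNIV. A $ i $ k *s V x $ k)"
        by (simp add: W_def vec_eq_iff matrix_matrix_mult_def)
      have "det (\<chi> j. if j = i then W $ i else V x $ j) =
          (\<Sum>k\<in>UNIV. det (\<chi> j. if j = i then A $ i $ k *s V x $ k else V x $ j))"
        unfolding row by (rule det_linear_row_sum) simp
      also have "\<dots> = (\<Sum>k\<in>UNIV. A $ i $ k * det (\<chi> j. if j = i then V x $ k else V x $ j))"
        by (simp add: det_row_mul)
      also have "\<dots> = (\<Sum>k\<in>UNIV. if k = i then A $ i $ i * det (V x) else 0)"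
      proof (rule sum.cong [OF refl])
        fix k
        show "A $ i $ k * det (\<chi> j. if j = i then V x $ k else V x $ j) =
            (if k = i then A $ i $ i * det (V x) else 0)"
        proof (cases "k = i")
          case True
          then have "(\<chi> j. if j = i then V x $ k else V x $ j) = V x"
            by (simp add: vec_eq_iff)
          then show ?thesis
            using True by simp
        next
          case False
          then have "det (\<chi> j. if j = i then V x $ k else V x $ j) = 0"
            by (intro det_identical_rows [of k i]) (auto simp: row_def vec_eq_iff)
          then show ?thesis
            using False by simp
        qed
      qed
      also have "\<dots> = A $ i $ i * det (V x)"
        by simp
      finally show ?thesis .
    qed
    then show ?thesis
      by (simp add: trace_def sum_distrib_right)
  qed
  ultimately show ?thesis
    by (simp add: has_vector_derivative_def)
qed

lemma has_vector_derivative_zero_imp_eq: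
  assumes "\<And>x. (f has_vector_derivative 0) (at x)"
  shows "f x = f y"
  using assms has_vector_derivative_zero_constant [of UNIV f] by (metis UNIV_I convex_UNIV)

text \<open>
  A Gronwall estimate. Working with the squared norm avoids the lack of differentiability of the
  norm at zero: the bound \<open>2 \<bar>D\<bar> d \<le> \<bar>D\<bar>\<^sup>2 + d\<^sup>2\<close> makes
  \<open>(\<bar>D\<bar>\<^sup>2 + d\<^sup>2) exp (- (2 K + 1) x)\<close> nonincreasing.
\<close>

lemma norm_le_of_norm_derivative_le:
  fixes D :: "real \<Rightarrow> 'a::real_inner"
  assumes T: "0 \<le> T" and K: "0 \<le> K" and d: "0 \<le> d" and D0: "D 0 = 0"
    and der: "\<And>x. x \<in> {0..T} \<Longrightarrow> (D has_vector_derivative D' x) (at x)"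
    and le: "\<And>x. x \<in> {0..T} \<Longrightarrow> norm (D' x) \<le> K * norm (D x) + d"
  shows "norm (D T) \<le> d * exp ((2 * K + 1) * T)"
proof -
  define c where "c = 2 * K + 1"
  define h where "h x = (D x \<bullet> D x + d\<^sup>2) * exp (- (c * x))" for x
  have "h T \<le> h 0"
  proof (rule DERIV_nonpos_imp_nonincreasing [OF T])
    fix x assume "0 \<le> x" "x \<le> T"
    then have x: "x \<in> {0..T}" by simp
    have "(h has_real_derivative
        (2 * (D x \<bullet> D' x)) * exp (- (c * x)) + (D x \<bullet> D x + d\<^sup>2) * (exp (- (c * x)) * - c)) (at x)"
    proof -
      have "((\<lambda>x. D x \<bullet> D x) has_real_derivative 2 * (D x \<bullet> D' x)) (at x)"
        using bounded_bilinear.has_vector_derivative [OF bounded_bilinear_inner der [OF x] der [OF x]]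
        by (simp add: has_real_derivative_iff_has_vector_derivative inner_commute)
      then show ?thesis
        unfolding h_def by (auto intro!: derivative_eq_intros simp: algebra_simps)
    qed
    moreover have "2 * (D x \<bullet> D' x) \<le> c * (D x \<bullet> D x + d\<^sup>2)"
    proof -
      have "D x \<bullet> D' x \<le> norm (D x) * norm (D' x)"
        by (rule norm_cauchy_schwarz)
      also have "\<dots> \<le> norm (D x) * (K * norm (D x) + d)"
        by (intro mult_left_mono le x) simp
      finally have "2 * (D x \<bullet> D' x) \<le> 2 * K * (norm (D x))\<^sup>2 + 2 * norm (D x) * d"
        by (simp add: algebra_simps power2_eq_square)
      also have "2 * norm (D x) * d \<le> (norm (D x))\<^sup>2 + d\<^sup>2"
        by (rule sum_squares_bound)
      also have "2 * K * (norm (D x))\<^sup>2 + ((norm (D x))\<^sup>2 + d\<^sup>2) \<le> c * ((norm (D x))\<^sup>2 + d\<^sup>2)"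
        using K by (simp add: c_def algebra_simps)
      finally show ?thesis
        by (simp add: power2_norm_eq_inner)
    qed
    then have "2 * (D x \<bullet> D' x) * exp (- (c * x)) \<le> c * (D x \<bullet> D x + d\<^sup>2) * exp (- (c * x))"
      by (intro mult_right_mono) auto
    ultimately show "\<exists>y. (h has_real_derivative y) (at x) \<and> y \<le> 0"
      by (intro exI conjI) (assumption, simp add: algebra_simps)
  qed
  then have "(norm (D T))\<^sup>2 + d\<^sup>2 \<le> d\<^sup>2 * exp (c * T)"
    by (simp add: h_def D0 power2_norm_eq_inner exp_minus field_simps)
  moreover have "d\<^sup>2 * exp (c * T) \<le> (d * exp (c * T))\<^sup>2"
  proof -
    have "1 \<le> exp (c * T)"
      using T K by (simp add: c_def)
    then have "exp (c * T) \<le> (exp (c * T))\<^sup>2"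
      by (rule self_le_power) simp
    then show ?thesis
      by (simp add: power_mult_distrib mult_left_mono)
  qed
  moreover have "0 \<le> d\<^sup>2"
    by simp
  ultimately have "(norm (D T))\<^sup>2 \<le> (d * exp (c * T))\<^sup>2"
    by linarith
  then show ?thesis
    unfolding c_def by (rule power2_le_imp_le) (simp add: d)
qed

text \<open>
  The difference of two solutions satisfies the Gronwall estimate with \<open>d = 0\<close>.
\<close>

lemma matrix_ode_unique:
  fixes V W :: "real \<Rightarrow> complex ^ 'n ^ 'n"
  assumes T: "0 \<le> T" and A: "continuous_on {0..T} A"
    and V: "\<And>x. x \<in> {0..T} \<Longrightarrow> (V has_vector_derivative A x ** V x) (at x)"
    and W: "\<And>x. x \<in> {0..T} \<Longrightarrow> (W has_vector_derivative A x ** W x) (at x)"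
    and init: "V 0 = W 0"
  shows "V T = W T"
proof -
  obtain C where C: "0 < C" "\<And>(X :: complex ^ 'n ^ 'n) (Y :: complex ^ 'n ^ 'n). norm (X ** Y) \<le> norm X * norm Y * C"
    using bounded_bilinear.pos_bounded [OF bounded_bilinear_matrix_matrix_mult] by blast
  obtain a where a: "0 < a" "\<And>x. x \<in> {0..T} \<Longrightarrow> norm (A x) \<le> a"
    using compact_imp_bounded [OF compact_continuous_image [OF A compact_Icc]]
    by (auto simp: bounded_pos)
  have "norm (V T - W T) \<le> 0 * exp ((2 * (a * C) + 1) * T)"
  proof (rule norm_le_of_norm_derivative_le [OF T])
    show "((\<lambda>x. V x - W x) has_vector_derivative A x ** (V x - W x)) (at x)" if "x \<in> {0..T}" for x
      using has_vector_derivative_diff [OF V [OF that] W [OF that]]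
      by (simp add: bounded_bilinear.diff_right [OF bounded_bilinear_matrix_matrix_mult])
    show "norm (A x ** (V x - W x)) \<le> a * C * norm (V x - W x) + 0" if "x \<in> {0..T}" for x
    proof -
      have "norm (A x ** (V x - W x)) \<le> norm (A x) * norm (V x - W x) * C"
        by (rule C)
      also have "\<dots> \<le> a * norm (V x - W x) * C"
        using C(1) by (intro mult_right_mono a that) auto
      finally show ?thesis
        by (simp add: algebra_simps)
    qed
  qed (use a C init in auto)
  then show ?thesis
    by simp
qed

text \<open>
  The difference \<open>D = V\<^sub>l - V\<^bsub>l0\<^esub>\<close> solves \<open>D' = A\<^sub>l D + (A\<^sub>l - A\<^bsub>l0\<^esub>) V\<^bsub>l0\<^esub>\<close>. The
  inhomogeneity is uniformly small on \<open>[0, T]\<close> for \<open>l\<close> near \<open>l0\<close>, by uniform continuity of \<open>A\<close> on a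
  compact set, and the Gronwall estimate bounds \<open>D(T)\<close> by a fixed multiple of it.
\<close>

lemma continuous_on_matrix_ode_parameter:
  fixes A :: "real \<Rightarrow> 'p::heine_borel \<Rightarrow> complex ^ 'n ^ 'n"
    and V :: "'p \<Rightarrow> real \<Rightarrow> complex ^ 'n ^ 'n"
  assumes T: "0 \<le> T" and A: "continuous_on UNIV (\<lambda>(x, l). A x l)"
    and V: "\<And>l x. (V l has_vector_derivative A x l ** V l x) (at x)"
    and init: "\<And>l. V l 0 = V\<^sub>0"
  shows "continuous_on UNIV (\<lambda>l. V l T)"
  unfolding continuous_on_iff
proof clarify
  fix l0 :: 'p and \<epsilon> :: real assume \<epsilon>: "0 < \<epsilon>"
  define S where "S = {0..T} \<times> cball l0 1"
  have "compact S"
    unfolding S_def by (intro compact_Times compact_Icc compact_cball)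
  have contS: "continuous_on S (\<lambda>(x, l). A x l)"
    using A continuous_on_subset by blast
  obtain C where C: "0 < C" "\<And>(X :: complex ^ 'n ^ 'n) (Y :: complex ^ 'n ^ 'n). norm (X ** Y) \<le> norm X * norm Y * C"
    using bounded_bilinear.pos_bounded [OF bounded_bilinear_matrix_matrix_mult] by blast
  obtain a where a: "0 < a" "\<And>x l. (x, l) \<in> S \<Longrightarrow> norm (A x l) \<le> a"
    using compact_imp_bounded [OF compact_continuous_image [OF contS \<open>compact S\<close>]]
    by (fastforce simp: bounded_pos)
  have "continuous_on {0..T} (V l0)"
    by (intro continuous_at_imp_continuous_on ballI has_vector_derivative_continuous [OF V])
  then obtain b where b: "0 < b" "\<And>x. x \<in> {0..T} \<Longrightarrow> norm (V l0 x) \<le> b"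
    using compact_imp_bounded [OF compact_continuous_image [OF _ compact_Icc]]
    by (force simp: bounded_pos)
  define E where "E = exp ((2 * (a * C) + 1) * T)"
  have E: "0 < E"
    by (simp add: E_def)
  \<comment> \<open>The Gronwall bound for \<open>D(T)\<close> will be \<open>\<delta> b C E\<close>, which this choice makes \<open>\<epsilon> / 2\<close>.\<close>
  define \<delta> where "\<delta> = \<epsilon> / (2 * (b * C * E))"
  have \<delta>: "0 < \<delta>"
    using \<epsilon> b(1) C(1) E by (simp add: \<delta>_def)
  obtain r where r: "0 < r"
    "\<And>p q. p \<in> S \<Longrightarrow> q \<in> S \<Longrightarrow> dist q p < r \<Longrightarrow> dist (case q of (x, l) \<Rightarrow> A x l) (case p of (x, l) \<Rightarrow> A x l) < \<delta>"
    using compact_uniformly_continuous [OF contS \<open>compact S\<close>] \<delta>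
    unfolding uniformly_continuous_on_def by blast
  show "\<exists>d>0. \<forall>l\<in>UNIV. dist l l0 < d \<longrightarrow> dist (V l T) (V l0 T) < \<epsilon>"
  proof (intro exI [of _ "min r 1"] conjI ballI impI)
    show "0 < min r 1"
      using r(1) by simp
    fix l assume l: "dist l l0 < min r 1"
    have mem: "(x, l) \<in> S" "(x, l0) \<in> S" if "x \<in> {0..T}" for x
      using that l by (auto simp: S_def dist_commute)
    have close: "norm (A x l - A x l0) \<le> \<delta>" if "x \<in> {0..T}" for x
      using r(2) [OF mem(2) mem(1), OF that that] l by (simp add: dist_Pair_Pair dist_norm)
    have "norm (V l T - V l0 T) \<le> \<delta> * b * C * exp ((2 * (a * C) + 1) * T)"
    proof (rule norm_le_of_norm_derivative_le [OF T])
      fix x assume x: "x \<in> {0..T}"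
      show "((\<lambda>x. V l x - V l0 x) has_vector_derivative
          A x l ** (V l x - V l0 x) + (A x l - A x l0) ** V l0 x) (at x)"
        using has_vector_derivative_diff [OF V [of l x] V [of l0 x]]
        by (simp add: bounded_bilinear.diff_right [OF bounded_bilinear_matrix_matrix_mult]
            bounded_bilinear.diff_left [OF bounded_bilinear_matrix_matrix_mult])
      have "norm (A x l ** (V l x - V l0 x)) \<le> norm (A x l) * norm (V l x - V l0 x) * C"
        by (rule C)
      also have "\<dots> \<le> a * norm (V l x - V l0 x) * C"
        using C(1) by (intro mult_right_mono a mem x) auto
      finally have 1: "norm (A x l ** (V l x - V l0 x)) \<le> a * C * norm (V l x - V l0 x)"
        by (simp add: algebra_simps)
      have "norm ((A x l - A x l0) ** V l0 x) \<le> norm (A x l - A x l0) * norm (V l0 x) * C"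
        by (rule C)
      also have "\<dots> \<le> \<delta> * b * C"
        using C(1) \<delta> by (intro mult_right_mono mult_mono close b x) auto
      finally show "norm (A x l ** (V l x - V l0 x) + (A x l - A x l0) ** V l0 x)
          \<le> a * C * norm (V l x - V l0 x) + \<delta> * b * C"
        using 1 norm_triangle_ineq [of "A x l ** (V l x - V l0 x)" "(A x l - A x l0) ** V l0 x"]
        by linarith
    qed (use a(1) b(1) C(1) \<delta> init in auto)
    also have "\<dots> = \<epsilon> / 2"
      unfolding E_def [symmetric] using b(1) C(1) E by (simp add: \<delta>_def)
    also have "\<dots> < \<epsilon>"
      using \<epsilon> by simp
    finally show "dist (V l T) (V l0 T) < \<epsilon>"
      by (simp add: dist_norm)
  qed
qed

section \<open>Extending identities by continuity and by analyticity\<close>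

lemma continuous_eq_off_finite:
  fixes f g :: "complex \<Rightarrow> 'b::t2_space"
  assumes "continuous_on UNIV f" "continuous_on UNIV g"
    and "finite S" "\<And>x. x \<notin> S \<Longrightarrow> f x = g x"
  shows "f x = g x"
proof -
  have "closed {x. f x = g x}"
    using assms(1,2) by (rule closed_Collect_eq)
  then have "closure (- S) \<subseteq> {x. f x = g x}"
    using assms(4) by (intro closure_minimal) auto
  moreover have "closure (- S) = UNIV"
    using assms(3) by (simp add: closure_complement empty_interior_finite)
  ultimately show ?thesis
    by auto
qed

text \<open>
  Schwarz reflection: \<open>f\<close> and \<open>cnj \<circ> f \<circ> cnj\<close> are both entire and agree on the real axis.
\<close>

lemma entire_real_on_reals_cnj:
  assumes f: "f holomorphic_on UNIV" and real: "\<And>z. z \<in> \<real> \<Longrightarrow> f z \<in> \<real>"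
  shows "f (cnj z) = cnj (f z)"
proof -
  have "(\<lambda>w. f w - (cnj \<circ> f \<circ> cnj) w) z' = 0" for z'
  proof (rule analytic_continuation [where f = "\<lambda>w. f w - (cnj \<circ> f \<circ> cnj) w" and S = UNIV and U = "\<real>" and \<xi> = 0])
    have "cnj \<circ> f \<circ> cnj holomorphic_on UNIV"
      using f by (intro holomorphic_on_compose_cnj_cnj) (auto intro: holomorphic_on_subset)
    with f show "(\<lambda>w. f w - (cnj \<circ> f \<circ> cnj) w) holomorphic_on UNIV"
      by (intro holomorphic_intros)
    show "(0::complex) islimpt \<real>"
      unfolding islimpt_approachable
    proof clarify
      fix e :: real assume "0 < e"
      then show "\<exists>x'\<in>\<real>. x' \<noteq> (0::complex) \<and> dist x' 0 < e"
        by (intro bexI [of _ "of_real (e / 2)"]) auto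
    qed
    show "f w - (cnj \<circ> f \<circ> cnj) w = 0" if "w \<in> \<real>" for w
      using real [OF that] that by (simp add: Reals_cnj_iff)
  qed auto
  from this [of "cnj z"] show ?thesis
    by simp
qed

section \<open>Symmetry of the monodromy matrix\<close>

text \<open>
  The hypothesis on \<open>A\<close> and \<open>A'\<close> is the statement that the derivative of \<open>V\<^sup>T B W\<close> vanishes.
\<close>

lemma monodromy_preserves_form:
  assumes V: "\<And>x. (V has_vector_derivative A x ** V x) (at x)" "V 0 = mat 1"
    and W: "\<And>x. (W has_vector_derivative A' x ** W x) (at x)" "W 0 = mat 1"
    and A: "\<And>x. transpose (A x) ** B = - (B ** A' x)"
  shows "transpose (V x) ** B ** W x = (B :: complex ^ 'n ^ 'n)"
proof -
  note bb = bounded_bilinear_matrix_matrix_mult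
  have "((\<lambda>x. transpose (V x) ** B ** W x) has_vector_derivative 0) (at x)" for x
  proof -
    have "((\<lambda>x. transpose (V x)) has_vector_derivative transpose (A x ** V x)) (at x)"
      by (rule bounded_linear.has_vector_derivative [OF bounded_linear_transpose V(1)])
    then have "((\<lambda>x. transpose (V x) ** B) has_vector_derivative transpose (A x ** V x) ** B) (at x)"
      by (rule bounded_linear.has_vector_derivative [OF bounded_bilinear.bounded_linear_left [OF bb]])
    from bounded_bilinear.has_vector_derivative [OF bb this W(1)]
    have "((\<lambda>x. transpose (V x) ** B ** W x) has_vector_derivative
        transpose (V x) ** B ** (A' x ** W x) + transpose (A x ** V x) ** B ** W x) (at x)" .
    moreover have "transpose (A x ** V x) ** B ** W x = transpose (V x) ** (transpose (A x) ** B) ** W x"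
      by (simp add: matrix_transpose_mul matrix_mul_assoc)
    ultimately show ?thesis
      by (simp add: A matrix_mul_assoc bounded_bilinear.minus_left [OF bb] bounded_bilinear.minus_right [OF bb])
  qed
  then have "transpose (V x) ** B ** W x = transpose (V 0) ** B ** W 0"
    by (rule has_vector_derivative_zero_imp_eq)
  then show ?thesis
    using V(2) W(2) by simp
qed

lemma form_preserving_inverse:
  fixes M M' B :: "complex ^ 'n ^ 'n"
  assumes form: "transpose M ** B ** M' = B" and B: "invertible B"
  shows "invertible M' \<and>
    M = transpose (matrix_inv B) ** transpose (matrix_inv M') ** transpose B"
proof
  have "det M * det B * det M' = det B"
    using arg_cong [OF form, of det] by (simp add: det_mul)
  then show M': "invertible M'"
    using B by (auto simp: invertible_det_nz)
  have "transpose B = transpose M' ** transpose B ** M"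
    using arg_cong [OF form, of transpose] by (simp add: matrix_transpose_mul matrix_mul_assoc)
  then have "transpose (matrix_inv B) ** transpose (matrix_inv M') ** transpose B =
      transpose (matrix_inv B) ** (transpose (matrix_inv M') ** transpose M') ** transpose B ** M"
    by (metis matrix_mul_assoc)
  also have "\<dots> = M"
    by (simp add: matrix_transpose_mul [symmetric] matrix_inv_right B M')
  finally show "M = transpose (matrix_inv B) ** transpose (matrix_inv M') ** transpose B" ..
qed

text \<open>
  Keeping \<open>B\<close> and \<open>M'\<close> on the right of \<open>M\<^sup>T - z\<close> makes the proof free of inverses:
  \<open>(M\<^sup>T - z) B M' = B - z B M' = B (I - z M')\<close>, and scalar matrices commute with \<open>B\<close>.
\<close>

lemma form_preserving_det:
  fixes M M' B :: "complex ^ 'n ^ 'n"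
  assumes form: "transpose M ** B ** M' = B" and B: "invertible B" and "det M' = 1"
  shows "det (M - mat z) = det (mat 1 - mat z ** M')"
proof -
  note bb = bounded_bilinear_matrix_matrix_mult
  have "transpose (M - mat z) = transpose M - mat z"
    by (auto simp: vec_eq_iff transpose_def mat_def)
  then have "transpose (M - mat z) ** B ** M' = B ** (mat 1 - mat z ** M')"
    by (simp add: bounded_bilinear.diff_left [OF bb] bounded_bilinear.diff_right [OF bb]
        form matrix_mul_assoc) (simp add: matrix_mul_assoc [symmetric] mat_mult_commute)
  from arg_cong [OF this, of det] show ?thesis
    using assms by (simp add: det_mul invertible_det_nz)
qed

theorem lemma1:
  fixes A :: "real \<Rightarrow> complex \<Rightarrow> complex ^ 'n ^ 'n"
    and B M :: "complex \<Rightarrow> complex ^ 'n ^ 'n"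
    and T :: real
    and \<mu> :: "complex \<Rightarrow> nat \<Rightarrow> complex"
    and e :: "nat \<Rightarrow> complex \<Rightarrow> complex"
    and n :: nat
  assumes n: "n = CARD('n)"
    and T_pos: "T > 0"
    and periodic: "\<And>x l. A (x + T) l = A x l"
    and A1: "\<And>x l i j. l \<in> \<real> \<Longrightarrow> A x l $ i $ j \<in> \<real>"
    and A2: "\<And>x l. transpose (A x l) ** B l = - (B l ** A x (- l))"
    and A2_nonsingular: "finite {l. \<not> invertible (B l)}"
    and monodromy: "\<And>l. is_monodromy_matrix (\<lambda>x. A x l) T (M l)"
    and eigenvalues: "\<And>l. enumerates_eigenvalues (\<mu> l) (M l)"
    and e: "\<And>k l. e k l = elem_sym n k (\<mu> l)"
  shows
    "(\<forall>l. invertible (B l) \<longrightarrow>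
        invertible (M (- l)) \<and>
        M l = transpose (matrix_inv (B l)) ** transpose (matrix_inv (M (- l))) ** transpose (B l))
     \<and>
     (\<forall>l z. det (M l - mat z) = (\<Sum>k=0..n. (- z) ^ k * e (n - k) l))
     \<and>
     ((\<forall>x l. trace (A x l) = 0) \<and> continuous_on UNIV (\<lambda>(x, l). A x l) \<longrightarrow>
        (\<forall>k\<le>n. \<forall>l. e k l = e (n - k) (- l)) \<and>
        ((\<forall>x i j. (\<lambda>l. A x l $ i $ j) holomorphic_on UNIV) \<longrightarrow>
           (\<forall>k\<le>n. \<forall>l. Re l = 0 \<longrightarrow> e k l = cnj (e (n - k) l)) \<and>
           (even n \<longrightarrow> (\<forall>l. Re l = 0 \<longrightarrow> e (n div 2) l \<in> \<real>))))"
proof -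
  obtain V where V0: "\<And>l. V l 0 = mat 1"
    and V: "\<And>l x. (V l has_vector_derivative A x l ** V l x) (at x)"
    and M: "\<And>l. M l = V l T"
    using monodromy unfolding is_monodromy_matrix_def by metis
  have form: "transpose (M l) ** B l ** M (- l) = B l" for l
    unfolding M by (rule monodromy_preserves_form [OF V V0 V V0 A2])
  have charpoly: "det (M l - mat z) = (\<Sum>k=0..n. (- z) ^ k * e (n - k) l)" for l z
    unfolding e n by (rule det_minus_mat_eq_sum_elem_sym [OF eigenvalues])
  have symmetry: "e k l = e (n - k) (- l)"
    if tr: "\<And>x l. trace (A x l) = 0" and cont: "continuous_on UNIV (\<lambda>(x, l). A x l)" and "k \<le> n"
    for k l
  proof -
    have det1: "det (M l) = 1" for l
    proof -
      have "det (V l T) = det (V l 0)"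
        using has_vector_derivative_det [OF V] by (intro has_vector_derivative_zero_imp_eq) (simp add: tr)
      then show ?thesis
        by (simp add: M V0)
    qed
    have contM: "continuous_on UNIV M"
      using continuous_on_matrix_ode_parameter [OF _ cont V V0, of T] T_pos by (simp add: M [abs_def])
    have "det (M l - mat z) = det (mat 1 - mat z ** M (- l))" for l z
    proof (rule continuous_eq_off_finite [where f = "\<lambda>l. det (M l - mat z)"
          and g = "\<lambda>l. det (mat 1 - mat z ** M (- l))", OF _ _ A2_nonsingular])
      show "continuous_on UNIV (\<lambda>l. det (M l - mat z))"
        by (intro continuous_on_det continuous_intros contM)
      show "continuous_on UNIV (\<lambda>l. det (mat 1 - mat z ** M (- l)))"
        by (intro continuous_on_det continuous_intros
            bounded_bilinear.continuous_on [OF bounded_bilinear_matrix_matrix_mult]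
            continuous_on_compose2 [OF contM]) auto
      show "det (M l - mat z) = det (mat 1 - mat z ** M (- l))"
        if "l \<notin> {l. \<not> invertible (B l)}" for l
        using that by (intro form_preserving_det [OF form] det1) simp
    qed
    then have "(\<Sum>k=0..n. (- z) ^ k * e (n - k) l) = (\<Sum>k=0..n. (- z) ^ k * e k (- l))" for z
      using det_one_minus_eq_sum_elem_sym [OF eigenvalues, of z "- l"] by (simp add: charpoly e n)
    from coeffs_eq_of_eval_neg [OF this, of "n - k"] show ?thesis
      using \<open>k \<le> n\<close> by simp
  qed
  have conj: "e k l = cnj (e (n - k) l)"
    if tr: "\<And>x l. trace (A x l) = 0" and cont: "continuous_on UNIV (\<lambda>(x, l). A x l)"
      and hol: "\<And>x i j. (\<lambda>l. A x l $ i $ j) holomorphic_on UNIV" and "k \<le> n" and "Re l = 0"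
    for k l
  proof -
    have A: "A x (cnj l) = map_matrix cnj (A x l)" for x
      using entire_real_on_reals_cnj [OF hol A1] by (simp add: vec_eq_iff)
    have "V (cnj l) T = map_matrix cnj (V l T)"
    proof (rule matrix_ode_unique)
      show "continuous_on {0..T} (\<lambda>x. A x (cnj l))"
      proof -
        have "continuous_on {0..T} (\<lambda>x. (x, cnj l))"
          by (intro continuous_intros)
        from continuous_on_compose2 [OF cont this] show ?thesis
          by simp
      qed
      show "((\<lambda>x. map_matrix cnj (V l x)) has_vector_derivative A x (cnj l) ** map_matrix cnj (V l x)) (at x)"
        for x
        using bounded_linear.has_vector_derivative [OF bounded_linear_map_matrix_cnj V]
        by (simp add: A map_matrix_cnj_mult)
      show "V (cnj l) 0 = map_matrix cnj (V l 0)"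
        by (auto simp: V0 vec_eq_iff mat_def)
    qed (use T_pos V in auto)
    then have "M (cnj l) - mat z = map_matrix cnj (M l - mat (cnj z))" for z
      by (auto simp: M vec_eq_iff mat_def)
    then have "det (M (cnj l) - mat z) = cnj (det (M l - mat (cnj z)))" for z
      by (simp add: det_map_matrix_cnj)
    then have "(\<Sum>k=0..n. (- z) ^ k * e (n - k) (cnj l)) = (\<Sum>k=0..n. (- z) ^ k * cnj (e (n - k) l))" for z
      by (simp add: charpoly)
    from coeffs_eq_of_eval_neg [OF this, of k] have "e (n - k) (cnj l) = cnj (e (n - k) l)"
      using \<open>k \<le> n\<close> by simp
    moreover have "cnj l = - l"
      using \<open>Re l = 0\<close> by (simp add: complex_eq_iff)
    ultimately show ?thesis
      using symmetry [OF tr cont \<open>k \<le> n\<close>, of l] by simp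
  qed
  have real: "e (n div 2) l \<in> \<real>"
    if "\<And>x l. trace (A x l) = 0" and "continuous_on UNIV (\<lambda>(x, l). A x l)"
      and "\<And>x i j. (\<lambda>l. A x l $ i $ j) holomorphic_on UNIV" and "even n" and "Re l = 0"
    for l
  proof -
    have "n - n div 2 = n div 2"
      using \<open>even n\<close> by auto
    then show ?thesis
      using conj [OF that(1,2,3) _ \<open>Re l = 0\<close>, of "n div 2"] by (simp add: Reals_cnj_iff)
  qed
  show ?thesis
  proof (intro conjI [OF _ conjI] impI allI)
    fix l assume "invertible (B l)"
    then show "invertible (M (- l)) \<and>
        M l = transpose (matrix_inv (B l)) ** transpose (matrix_inv (M (- l))) ** transpose (B l)"
      by (rule form_preserving_inverse [OF form])
  next
    fix l z show "det (M l - mat z) = (\<Sum>k=0..n. (- z) ^ k * e (n - k) l)"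
      by (rule charpoly)
  next
    assume "(\<forall>x l. trace (A x l) = 0) \<and> continuous_on UNIV (\<lambda>(x, l). A x l)"
    then have tr: "\<And>x l. trace (A x l) = 0" and cont: "continuous_on UNIV (\<lambda>(x, l). A x l)"
      by auto
    show "(\<forall>k\<le>n. \<forall>l. e k l = e (n - k) (- l)) \<and>
        ((\<forall>x i j. (\<lambda>l. A x l $ i $ j) holomorphic_on UNIV) \<longrightarrow>
           (\<forall>k\<le>n. \<forall>l. Re l = 0 \<longrightarrow> e k l = cnj (e (n - k) l)) \<and>
           (even n \<longrightarrow> (\<forall>l. Re l = 0 \<longrightarrow> e (n div 2) l \<in> \<real>)))"
    proof (intro conjI impI allI)
      show "e k l = e (n - k) (- l)" if "k \<le> n" for k l
        by (rule symmetry [OF tr cont that])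
      assume "\<forall>x i j. (\<lambda>l. A x l $ i $ j) holomorphic_on UNIV"
      then have hol: "\<And>x i j. (\<lambda>l. A x l $ i $ j) holomorphic_on UNIV"
        by blast
      show "e k l = cnj (e (n - k) l)" if "k \<le> n" "Re l = 0" for k l
        by (rule conj [OF tr cont hol that])
      show "e (n div 2) l \<in> \<real>" if "even n" "Re l = 0" for l
        by (rule real [OF tr cont hol that])
    qed
  qed
qed

end
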